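(* If there is an Ł$_{3_\vee}$ proof of a formula $D$ in $n$ steps, then there is an $\mathcal{H}\text{Łuk}$ proof of $D$ in $O(n^2\log n)$ steps.
   Context: Formulas are built from propositional variables with $\wedge,\vee,\supset,\neg$. $\mathcal{H}\text{Łuk}$ (Avron's Frege system for 3-valued Łukasiewicz logic) has the axiom schemas: (1) $A\supset(B\supset A)$; (2) $(A\supset B)\supset((B\supset C)\supset(A\supset C))$; (3) $((A\supset B)\supset B)\supset((B\supset A)\supset A)$; (4) $((((A\supset B)\supset A)\supset A)\supset(B\supset C))\supset(B\supset C)$; (5) $(A\wedge B)\supset A$; (6) $(A\wedge B)\supset B$; (7) $(A\supset B)\supset((A\supset C)\supset(A\supset(B\wedge C)))$; (8) $A\supset(A\vee B)$; (9) $B\supset(A\vee B)$; (10) $(A\supset C)\supset((B\supset C)\supset((A\vee B)\supset C))$; (11) $(\neg B\supset\neg A)\supset(A\supset B)$; sole rule modus ponens; a proof is a sequence of formulas, steps = its length. Ł$_{3_\vee}$: each step is a sequent $\Gamma\Rightarrow A$ with $\Gamma$ a finite (possibly empty) set of formulas. Axioms: $\Rightarrow A$ for every instance $A$ of an $\mathcal{H}\text{Łuk}$ axiom schema, and $\{A\}\Rightarrow A$ for every formula $A$. Rules: modus ponens (from $\Gamma_i\Rightarrow A$ and $\Gamma_j\Rightarrow A\supset B$ infer $\Gamma_i\cup\Gamma_j\Rightarrow B$) and $\vee_e$ (from $\Gamma_i\Rightarrow A\vee B$, $\Gamma_j\cup\{A\}\Rightarrow C$, $\Gamma_k\cup\{B\}\Rightarrow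 C$ infer $(\Gamma_i\cup\Gamma_j\cup\Gamma_k)\setminus\{A,B\}\Rightarrow C$). A proof of $D$ is a finite sequence of sequents, each an axiom or obtained from earlier ones by a rule, whose last sequent is $\Rightarrow D$; steps = number of sequents.
   Formalization: The rule ∨e is corrected: its conclusion has antecedent Γ_i ∪ (Γ_j∖{A}) ∪ (Γ_k∖{B}) instead of (Γ_i∪Γ_j∪Γ_k)∖{A,B}, since the literal rule is unsound (it proves ⇒p from {p}⇒p∨p and {p}⇒p), which makes the claim false. *)

theory Defs
  imports "HOL-Library.Landau_Symbols"
begin

datatype fm =
    Var nat
  | Neg fm
  | And fm fm  (infixr \<open>\<^bold>\<and>\<close> 75)
  | Or fm fm  (infixr \<open>\<^bold>\<or>\<close> 70)
  | Imp fm fm  (infixr \<open>\<^bold>\<supset>\<close> 65)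

inductive HLuk_axiom :: "fm \<Rightarrow> bool" where
  ax1: "HLuk_axiom (A \<^bold>\<supset> (B \<^bold>\<supset> A))"
| ax2: "HLuk_axiom ((A \<^bold>\<supset> B) \<^bold>\<supset> ((B \<^bold>\<supset> C) \<^bold>\<supset> (A \<^bold>\<supset> C)))"
| ax3: "HLuk_axiom (((A \<^bold>\<supset> B) \<^bold>\<supset> B) \<^bold>\<supset> ((B \<^bold>\<supset> A) \<^bold>\<supset> A))"
| ax4: "HLuk_axiom (((((A \<^bold>\<supset> B) \<^bold>\<supset> A) \<^bold>\<supset> A) \<^bold>\<supset> (B \<^bold>\<supset> C)) \<^bold>\<supset> (B \<^bold>\<supset> C))"
| ax5: "HLuk_axiom ((A \<^bold>\<and> B) \<^bold>\<supset> A)"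
| ax6: "HLuk_axiom ((A \<^bold>\<and> B) \<^bold>\<supset> B)"
| ax7: "HLuk_axiom ((A \<^bold>\<supset> B) \<^bold>\<supset> ((A \<^bold>\<supset> C) \<^bold>\<supset> (A \<^bold>\<supset> (B \<^bold>\<and> C))))"
| ax8: "HLuk_axiom (A \<^bold>\<supset> (A \<^bold>\<or> B))"
| ax9: "HLuk_axiom (B \<^bold>\<supset> (A \<^bold>\<or> B))"
| ax10: "HLuk_axiom ((A \<^bold>\<supset> C) \<^bold>\<supset> ((B \<^bold>\<supset> C) \<^bold>\<supset> ((A \<^bold>\<or> B) \<^bold>\<supset> C)))"
| ax11: "HLuk_axiom ((Neg B \<^bold>\<supset> Neg A) \<^bold>\<supset> (A \<^bold>\<supset> B))"

definition HLuk_proof :: "fm list \<Rightarrow> fm \<Rightarrow> bool" where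
  "HLuk_proof ps D \<longleftrightarrow>
     ps \<noteq> [] \<and> last ps = D \<and>
     (\<forall>i<length ps. HLuk_axiom (ps ! i) \<or> (\<exists>j<i. \<exists>k<i. ps ! k = (ps ! j \<^bold>\<supset> ps ! i)))"

text \<open>
  Antecedents are plain sets: in a proof they are automatically finite, since the axioms
  have at most one formula in the antecedent and the rules preserve finiteness.
\<close>

datatype sequent = Sequent "fm set" fm  (infix \<open>\<^bold>\<turnstile>\<close> 60)

inductive L3or_axiom :: "sequent \<Rightarrow> bool" where
  HLuk: "HLuk_axiom A \<Longrightarrow> L3or_axiom ({} \<^bold>\<turnstile> A)"
| assumption: "L3or_axiom ({A} \<^bold>\<turnstile> A)"

inductive L3or_mp :: "sequent \<Rightarrow> sequent \<Rightarrow> sequent \<Rightarrow> bool" where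
  "L3or_mp (\<Gamma>1 \<^bold>\<turnstile> A) (\<Gamma>2 \<^bold>\<turnstile> A \<^bold>\<supset> B) (\<Gamma>1 \<union> \<Gamma>2 \<^bold>\<turnstile> B)"

text \<open>
  Disjunction elimination discharges \<open>A\<close> from the second premise and \<open>B\<close> from the third.
  When \<open>A \<notin> \<Gamma>1 \<union> \<Gamma>3\<close> and \<open>B \<notin> \<Gamma>1 \<union> \<Gamma>2\<close>, the antecedent of the conclusion
  is \<open>(\<Gamma>1 \<union> \<Gamma>2 \<union> \<Gamma>3) - {A, B}\<close>. Without that proviso the latter expression would also
  delete \<open>A\<close> and \<open>B\<close> from premises that do not discharge them, which is unsound: from
  \<open>{A} \<^bold>\<turnstile> A \<^bold>\<or> A\<close> and \<open>{A} \<^bold>\<turnstile> A\<close> it would yield \<open>{} \<^bold>\<turnstile> A\<close> for every formula \<open>A\<close>.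
\<close>

inductive L3or_disjE :: "sequent \<Rightarrow> sequent \<Rightarrow> sequent \<Rightarrow> sequent \<Rightarrow> bool" where
  "L3or_disjE (\<Gamma>1 \<^bold>\<turnstile> A \<^bold>\<or> B) (\<Gamma>2 \<union> {A} \<^bold>\<turnstile> C) (\<Gamma>3 \<union> {B} \<^bold>\<turnstile> C)
     (\<Gamma>1 \<union> (\<Gamma>2 - {A}) \<union> (\<Gamma>3 - {B}) \<^bold>\<turnstile> C)"

definition L3or_proof :: "sequent list \<Rightarrow> fm \<Rightarrow> bool" where
  "L3or_proof ss D \<longleftrightarrow>
     ss \<noteq> [] \<and> last ss = ({} \<^bold>\<turnstile> D) \<and>
     (\<forall>i<length ss.
        L3or_axiom (ss ! i) \<or>
        (\<exists>j<i. \<exists>k<i. L3or_mp (ss ! j) (ss ! k) (ss ! i)) \<or>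
        (\<exists>j<i. \<exists>k<i. \<exists>l<i. L3or_disjE (ss ! j) (ss ! k) (ss ! l) (ss ! i)))"

end

theory Submission
  imports Defs
begin

text \<open>
  A sequent is translated into a single formula \<open>G \<^bold>\<supset> (G \<^bold>\<supset> C)\<close>, where \<open>G\<close> is the conjunction of the
  antecedent, listed in an order that is fixed for the whole proof. The doubled implication
  satisfies the deduction theorem of three-valued logic, because \<open>G \<^bold>\<supset> (G \<^bold>\<supset> (G \<^bold>\<supset> C))\<close> contracts to
  \<open>G \<^bold>\<supset> (G \<^bold>\<supset> C)\<close>, and disjunction elimination for it follows from prelinearity
  \<open>((A \<^bold>\<supset> B) \<^bold>\<supset> (B \<^bold>\<supset> A)) \<^bold>\<supset> (B \<^bold>\<supset> A)\<close>. With a fixed order, passing between the conjunctions of two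
  antecedents takes linearly many lines, and everything else constantly many, since substitution
  preserves proof length. This even gives a quadratic bound.
\<close>

section \<open>Derivability from hypotheses\<close>

inductive prv :: "fm set \<Rightarrow> fm \<Rightarrow> bool" (infix \<open>\<tturnstile>\<close> 50) for S where
  hyp: "A \<in> S \<Longrightarrow> S \<tturnstile> A"
| ax: "HLuk_axiom A \<Longrightarrow> S \<tturnstile> A"
| mp: "S \<tturnstile> A \<Longrightarrow> S \<tturnstile> A \<^bold>\<supset> B \<Longrightarrow> S \<tturnstile> B"

lemmas prv_axs = HLuk_axiom.intros[THEN prv.ax]

section \<open>Implicational reasoning from \<open>ax1\<close>, \<open>ax2\<close> and
  \<open>ax3\<close>\<close>

lemma prv_weaken: "S \<tturnstile> B \<Longrightarrow> S \<tturnstile> A \<^bold>\<supset> B"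
  by (rule prv.mp[OF _ prv_axs(1)])

lemma prv_trans: "S \<tturnstile> A \<^bold>\<supset> B \<Longrightarrow> S \<tturnstile> B \<^bold>\<supset> C \<Longrightarrow> S \<tturnstile> A \<^bold>\<supset> C"
  by (meson prv.mp prv_axs(2))

lemma prv_prefix: "S \<tturnstile> A \<^bold>\<supset> B \<Longrightarrow> S \<tturnstile> (B \<^bold>\<supset> C) \<^bold>\<supset> (A \<^bold>\<supset> C)"
  by (meson prv.mp prv_axs(2))

lemma prv_swap: "S \<tturnstile> (A \<^bold>\<supset> B) \<^bold>\<supset> B \<Longrightarrow> S \<tturnstile> (B \<^bold>\<supset> A) \<^bold>\<supset> A"
  by (meson prv.mp prv_axs(3))

text \<open>By \<open>ax1\<close>, \<open>A\<close> implies
  \<open>(B \<supset> A) \<supset> A\<close>, the Lukasiewicz disjunction, and \<open>ax3\<close>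
  makes that disjunction commutative.\<close>

lemma prv_pon: "S \<tturnstile> A \<^bold>\<supset> ((A \<^bold>\<supset> B) \<^bold>\<supset> B)"
  by (rule prv_trans[OF prv_axs(1) prv_axs(3)])

lemma prv_perm: "S \<tturnstile> A \<^bold>\<supset> (B \<^bold>\<supset> C) \<Longrightarrow> S \<tturnstile> B \<^bold>\<supset> (A \<^bold>\<supset> C)"
  by (rule prv_trans[OF prv_pon prv_prefix])

lemma prv_exchange: "S \<tturnstile> (A \<^bold>\<supset> (B \<^bold>\<supset> C)) \<^bold>\<supset> (B \<^bold>\<supset> (A \<^bold>\<supset> C))"
  by (rule prv_trans[OF prv_axs(2) prv_prefix[OF prv_pon]])

lemma prv_suffix: "S \<tturnstile> B \<^bold>\<supset> C \<Longrightarrow> S \<tturnstile> (A \<^bold>\<supset> B) \<^bold>\<supset> (A \<^bold>\<supset> C)"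
  by (rule prv.mp[OF _ prv_perm[OF prv_axs(2)]])

lemma prv_refl: "S \<tturnstile> A \<^bold>\<supset> A"
  by (rule prv.mp[OF prv_axs(1) prv_perm[OF prv_axs(1)]])

section \<open>Restricted forms of Peirce's law, and contraction from three copies to two\<close>

lemma prv_weak_peirce: "S \<tturnstile> (A \<^bold>\<supset> ((B \<^bold>\<supset> A) \<^bold>\<supset> B)) \<^bold>\<supset> (A \<^bold>\<supset> B)"
  by (rule prv_trans[OF prv_axs(2) prv_axs(4)])

text \<open>\<open>ax4\<close> says that Peirce's formula acts as a disjunct alternative to
  \<open>B \<supset> C\<close>; after \<open>prv_swap\<close>, it suffices to derive it from
  \<open>B \<supset> C\<close>, for any convenient \<open>C\<close>.\<close>

lemma prv_peirceI:
  assumes "S \<tturnstile> (B \<^bold>\<supset> C) \<^bold>\<supset> (((A \<^bold>\<supset> B) \<^bold>\<supset> A) \<^bold>\<supset> A)"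
  shows "S \<tturnstile> ((A \<^bold>\<supset> B) \<^bold>\<supset> A) \<^bold>\<supset> A"
  by (rule prv.mp[OF assms prv_swap[OF prv_axs(4)]])

text \<open>Peirce's law for the pair \<open>A \<supset> B\<close>, \<open>A\<close>: the auxiliary
  implication that \<open>prv_peirceI\<close> provides can be chosen as
  \<open>A \<supset> B\<close>, the consequent itself, so \<open>ax1\<close> is enough.\<close>

lemma prv_peirce_imp: "S \<tturnstile> (((A \<^bold>\<supset> B) \<^bold>\<supset> A) \<^bold>\<supset> (A \<^bold>\<supset> B)) \<^bold>\<supset> (A \<^bold>\<supset> B)"
  by (rule prv_peirceI[OF prv_axs(1)])

text \<open>Since \<open>(B \<supset> A) \<supset> B\<close> implies \<open>A \<supset> B\<close>,
  the premise strengthens to that of \<open>prv_peirce_imp\<close> with \<open>A\<close> and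
  \<open>B\<close> exchanged.\<close>

lemma prv_prelinearity: "S \<tturnstile> ((A \<^bold>\<supset> B) \<^bold>\<supset> (B \<^bold>\<supset> A)) \<^bold>\<supset> (B \<^bold>\<supset> A)"
proof -
  have "S \<tturnstile> ((B \<^bold>\<supset> A) \<^bold>\<supset> B) \<^bold>\<supset> (A \<^bold>\<supset> B)"
    by (rule prv_trans[OF prv_axs(1) prv_weak_peirce])
  then show ?thesis
    by (rule prv_trans[OF prv_prefix prv_peirce_imp])
qed

text \<open>Plain Peirce's law fails at \<open>A\<close> = 1/2, \<open>B\<close> = 0; the second
  \<open>A\<close> raises the inner implication to 1 there.\<close>

lemma prv_peirce_square: "S \<tturnstile> ((A \<^bold>\<supset> (A \<^bold>\<supset> B)) \<^bold>\<supset> A) \<^bold>\<supset> A"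
proof -
  let ?Z = "(A \<^bold>\<supset> (A \<^bold>\<supset> B)) \<^bold>\<supset> A"
  have "S \<tturnstile> ?Z \<^bold>\<supset> ((A \<^bold>\<supset> B) \<^bold>\<supset> A)"
    by (rule prv_trans[OF prv_axs(1) prv_weak_peirce])
  then have "S \<tturnstile> ?Z \<^bold>\<supset> (B \<^bold>\<supset> ((A \<^bold>\<supset> B) \<^bold>\<supset> A))"
    by (rule prv_trans[OF _ prv_axs(1)])
  then have "S \<tturnstile> ?Z \<^bold>\<supset> (B \<^bold>\<supset> A)"
    by (rule prv_trans[OF _ prv_weak_peirce])
  then have "S \<tturnstile> ((B \<^bold>\<supset> A) \<^bold>\<supset> A) \<^bold>\<supset> (?Z \<^bold>\<supset> A)"
    by (rule prv_prefix)
  then have "S \<tturnstile> ((A \<^bold>\<supset> B) \<^bold>\<supset> B) \<^bold>\<supset> (?Z \<^bold>\<supset> A)"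
    by (rule prv_trans[OF prv_axs(3)])
  \<comment> \<open>The rule is used with \<open>A \<supset> B\<close> as its \<open>B\<close> and
    \<open>B\<close> as its \<open>C\<close>, so that its auxiliary implication is
    \<open>(A \<supset> B) \<supset> B\<close>.\<close>
  then show ?thesis
    by (rule prv_peirceI)
qed

text \<open>With \<open>X\<close> for the conclusion, the premise is \<open>A \<supset> X\<close>.
  It turns \<open>prv_peirce_square\<close> into \<open>(X \<supset> A) \<supset> X\<close>, from
  which \<open>prv_peirce_imp\<close> extracts \<open>X\<close>.\<close>

lemma prv_contract:
  assumes "S \<tturnstile> A \<^bold>\<supset> (A \<^bold>\<supset> (A \<^bold>\<supset> B))"
  shows "S \<tturnstile> A \<^bold>\<supset> (A \<^bold>\<supset> B)"
  by (rule prv.mp[OF prv_trans[OF prv_peirce_square assms] prv_peirce_imp])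

section \<open>Deduction theorem with doubled implication, and disjunction elimination\<close>

lemma prv_mp_twice:
  assumes A: "S \<tturnstile> G \<^bold>\<supset> (G \<^bold>\<supset> A)" and AB: "S \<tturnstile> G \<^bold>\<supset> (G \<^bold>\<supset> (A \<^bold>\<supset> B))"
  shows "S \<tturnstile> G \<^bold>\<supset> (G \<^bold>\<supset> B)"
proof -
  have "S \<tturnstile> G \<^bold>\<supset> (A \<^bold>\<supset> (G \<^bold>\<supset> B))"
    by (rule prv_trans[OF AB prv_exchange])
  then have "S \<tturnstile> A \<^bold>\<supset> (G \<^bold>\<supset> (G \<^bold>\<supset> B))"
    by (rule prv_perm)
  \<comment> \<open>Each premise contributes two copies of \<open>G\<close>; two contractions bring
    the four back to two.\<close>
  then have "S \<tturnstile> G \<^bold>\<supset> (G \<^bold>\<supset> (G \<^bold>\<supset> (G \<^bold>\<supset> B)))"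
    by (rule prv_trans[OF A prv_suffix])
  then show ?thesis
    by (rule prv_contract[OF prv_contract])
qed

theorem prv_deduction:
  assumes "insert G S \<tturnstile> A"
  shows "S \<tturnstile> G \<^bold>\<supset> (G \<^bold>\<supset> A)"
  using assms
proof induction
  case (hyp A)
  show ?case
  proof (cases "A = G")
    case True
    then show ?thesis
      by (simp add: prv_axs(1))
  next
    case False
    then show ?thesis
      using hyp by (auto intro: prv_weaken[OF prv_weaken] prv.hyp)
  qed
next
  case (ax A)
  then show ?case
    by (rule prv_weaken[OF prv_weaken[OF prv.ax]])
next
  case (mp A B)
  then show ?case
    by (intro prv_mp_twice[of _ _ A B])
qed

text \<open>Prelinearity first yields the mixed implication
  \<open>A \<supset> (B \<supset> C)\<close>. Then \<open>ax10\<close> removes one antecedent at a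
  time, in three uses.\<close>

lemma prv_disjE:
  assumes "S \<tturnstile> A \<^bold>\<or> B" and A: "insert A S \<tturnstile> C" and B: "insert B S \<tturnstile> C"
  shows "S \<tturnstile> C"
proof -
  have elim: "S \<tturnstile> X" if "S \<tturnstile> A \<^bold>\<supset> X" "S \<tturnstile> B \<^bold>\<supset> X" for X
    using that assms(1) by (meson prv.mp prv_axs(10))
  have AAC: "S \<tturnstile> A \<^bold>\<supset> (A \<^bold>\<supset> C)" and BBC: "S \<tturnstile> B \<^bold>\<supset> (B \<^bold>\<supset> C)"
    using A B by (auto intro: prv_deduction)
  \<comment> \<open>\<open>A \<supset> (B \<supset> C)\<close> follows from
    \<open>A \<supset> B\<close> through \<open>BBC\<close> and from \<open>B \<supset> A\<close>
    through \<open>AAC\<close>; prelinearity joins the two cases.\<close>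
  have "S \<tturnstile> (A \<^bold>\<supset> B) \<^bold>\<supset> (A \<^bold>\<supset> (B \<^bold>\<supset> C))"
    by (rule prv_suffix[OF BBC])
  then have "S \<tturnstile> ((A \<^bold>\<supset> (B \<^bold>\<supset> C)) \<^bold>\<supset> (B \<^bold>\<supset> A)) \<^bold>\<supset> (B \<^bold>\<supset> A)"
    by (rule prv_trans[OF prv_prefix prv_prelinearity])
  then have "S \<tturnstile> ((B \<^bold>\<supset> A) \<^bold>\<supset> (A \<^bold>\<supset> (B \<^bold>\<supset> C))) \<^bold>\<supset> (A \<^bold>\<supset> (B \<^bold>\<supset> C))"
    by (rule prv_swap)
  moreover have "S \<tturnstile> (B \<^bold>\<supset> A) \<^bold>\<supset> (A \<^bold>\<supset> (B \<^bold>\<supset> C))"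
    by (rule prv_trans[OF prv_suffix[OF AAC] prv_exchange])
  ultimately have ABC: "S \<tturnstile> A \<^bold>\<supset> (B \<^bold>\<supset> C)"
    by (blast intro: prv.mp)
  have "S \<tturnstile> A \<^bold>\<supset> C"
    by (rule elim[OF AAC prv_perm[OF ABC]])
  moreover have "S \<tturnstile> B \<^bold>\<supset> C"
    by (rule elim[OF ABC BBC])
  ultimately show ?thesis
    by (rule elim)
qed

lemma prv_undeduction: "S \<tturnstile> G \<Longrightarrow> S \<tturnstile> G \<^bold>\<supset> (G \<^bold>\<supset> A) \<Longrightarrow> S \<tturnstile> A"
  by (blast intro: prv.mp)

lemma prv_conjI: "S \<tturnstile> A \<Longrightarrow> S \<tturnstile> B \<Longrightarrow> S \<tturnstile> A \<^bold>\<and> B"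
  by (meson prv.mp prv_axs(7) prv_refl prv_weaken)

lemma prv_imp_conjI: "S \<tturnstile> G \<^bold>\<supset> A \<Longrightarrow> S \<tturnstile> G \<^bold>\<supset> B \<Longrightarrow> S \<tturnstile> G \<^bold>\<supset> (A \<^bold>\<and> B)"
  by (meson prv.mp prv_axs(7))

section \<open>Counting lines\<close>

text \<open>Hypotheses are available without being listed, so they cost no lines. Sets of earlier
  lines instead of indices make concatenation easy.\<close>

definition derivation :: "fm set \<Rightarrow> fm list \<Rightarrow> bool" where
  "derivation S qs \<longleftrightarrow>
     (\<forall>i<length qs. HLuk_axiom (qs ! i) \<or>
        (\<exists>A \<in> S \<union> set (take i qs). A \<^bold>\<supset> qs ! i \<in> S \<union> set (take i qs)))"

text \<open>A whole set of targets is reached by one list, so lines shared between targets are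
  counted once.\<close>

definition derives_in :: "fm set \<Rightarrow> nat \<Rightarrow> fm set \<Rightarrow> bool" where
  "derives_in S k T \<longleftrightarrow> (\<exists>qs. derivation S qs \<and> length qs \<le> k \<and> T \<subseteq> S \<union> set qs)"

lemma derivation_append:
  assumes "derivation S ps" "derivation (S \<union> T) qs" "T \<subseteq> S \<union> set ps"
  shows "derivation S (ps @ qs)"
  unfolding derivation_def
proof (intro allI impI)
  fix i assume i: "i < length (ps @ qs)"
  show "HLuk_axiom ((ps @ qs) ! i) \<or>
    (\<exists>A \<in> S \<union> set (take i (ps @ qs)). A \<^bold>\<supset> (ps @ qs) ! i \<in> S \<union> set (take i (ps @ qs)))"
  proof (cases "i < length ps")
    case True
    then show ?thesis
      using assms(1) by (simp add: derivation_def nth_append)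
  next
    case False
    then have "S \<union> T \<union> set (take (i - length ps) qs) \<subseteq> S \<union> set (take i (ps @ qs))"
      using assms(3) by auto
    moreover have "i - length ps < length qs" and "(ps @ qs) ! i = qs ! (i - length ps)"
      using False i by (auto simp: nth_append)
    ultimately show ?thesis
      using assms(2) unfolding derivation_def by (metis subsetD)
  qed
qed

lemma derivation_mono: "derivation S qs \<Longrightarrow> S \<subseteq> S' \<Longrightarrow> derivation S' qs"
  unfolding derivation_def by blast

lemma derives_in_mono:
  assumes "derives_in S k T" "S \<subseteq> S'" "k \<le> k'" "T' \<subseteq> T"
  shows "derives_in S' k' T'"
proof -
  obtain qs where "derivation S qs" "length qs \<le> k" "T \<subseteq> S \<union> set qs"
    using assms(1) unfolding derives_in_def by blast
  then show ?thesis
    unfolding derives_in_def using assms(2-4)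
    by (intro exI[of _ qs]) (auto intro: derivation_mono)
qed

text \<open>Costs add because \<open>T\<close> stays available after being derived once; reuse of
  earlier lines never multiplies the count.\<close>

lemma derives_in_cut:
  assumes "derives_in S k T" "derives_in (S \<union> T) m U"
  shows "derives_in S (k + m) (T \<union> U)"
proof -
  obtain ps qs where "derivation S ps" "length ps \<le> k" "T \<subseteq> S \<union> set ps"
    "derivation (S \<union> T) qs" "length qs \<le> m" "U \<subseteq> (S \<union> T) \<union> set qs"
    using assms unfolding derives_in_def by blast
  then show ?thesis
    unfolding derives_in_def by (intro exI[of _ "ps @ qs"]) (auto intro: derivation_append)
qed

lemma derives_in_Un:
  assumes "derives_in S k T" "derives_in S m U"
  shows "derives_in S (k + m) (T \<union> U)"
  by (rule derives_in_cut[OF assms(1) derives_in_mono[OF assms(2)]]) auto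

lemma derives_in_then:
  assumes "derives_in S k T" "derives_in T m U"
  shows "derives_in S (k + m) U"
  by (rule derives_in_mono[OF derives_in_cut[OF assms(1) derives_in_mono[OF assms(2)]]]) auto

lemma derives_in_hyp: "T \<subseteq> S \<Longrightarrow> derives_in S 0 T"
  unfolding derives_in_def derivation_def by (intro exI[of _ "[]"]) auto

lemma derives_in_ax: "HLuk_axiom A \<Longrightarrow> derives_in S 1 {A}"
  unfolding derives_in_def derivation_def by (intro exI[of _ "[A]"]) auto

lemma derives_in_mp: "A \<in> S \<Longrightarrow> A \<^bold>\<supset> B \<in> S \<Longrightarrow> derives_in S 1 {B}"
  unfolding derives_in_def derivation_def by (intro exI[of _ "[B]"]) auto

lemma HLuk_proof_if_derives_in:
  assumes "derives_in {} k {D}"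
  shows "\<exists>ps. HLuk_proof ps D \<and> length ps \<le> k"
proof -
  obtain qs where qs: "derivation {} qs" "length qs \<le> k" "D \<in> set qs"
    using assms unfolding derives_in_def by auto
  then obtain n where n: "n < length qs" "qs ! n = D"
    by (auto simp: in_set_conv_nth)
  have nth_take_iff: "A \<in> set (take i qs) \<longleftrightarrow> (\<exists>j<i. qs ! j = A)" if "i < length qs" for A i
    using that by (auto simp: in_set_conv_nth)
  \<comment> \<open>\<open>D\<close> may occur before the end of \<open>qs\<close>; truncating just
    after an occurrence makes it the last line.\<close>
  have "HLuk_proof (take (Suc n) qs) D"
    unfolding HLuk_proof_def
  proof (intro conjI allI impI)
    show "take (Suc n) qs \<noteq> []" "last (take (Suc n) qs) = D"
      using n by (auto simp: take_Suc_conv_app_nth)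
    fix i assume i: "i < length (take (Suc n) qs)"
    then consider "HLuk_axiom (qs ! i)" |
      A where "A \<in> set (take i qs)" "A \<^bold>\<supset> qs ! i \<in> set (take i qs)"
      using qs(1) unfolding derivation_def by auto
    then show "HLuk_axiom (take (Suc n) qs ! i) \<or>
      (\<exists>j<i. \<exists>k<i. take (Suc n) qs ! k = (take (Suc n) qs ! j \<^bold>\<supset> take (Suc n) qs ! i))"
    proof cases
      case 1
      then show ?thesis
        using i by simp
    next
      case 2
      then obtain j k where "j < i" "k < i" "qs ! k = (qs ! j \<^bold>\<supset> qs ! i)"
        using i by (auto simp: nth_take_iff)
      then show ?thesis
        using i by (intro disjI2 exI[of _ j] exI[of _ k] conjI) auto
    qed
  qed
  moreover have "length (take (Suc n) qs) \<le> k"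
    using qs(2) by simp
  ultimately show ?thesis
    by blast
qed

section \<open>Uniform bounds for schemas\<close>

primrec subst :: "(nat \<Rightarrow> fm) \<Rightarrow> fm \<Rightarrow> fm" where
  "subst \<sigma> (Var n) = \<sigma> n"
| "subst \<sigma> (Neg A) = Neg (subst \<sigma> A)"
| "subst \<sigma> (A \<^bold>\<and> B) = subst \<sigma> A \<^bold>\<and> subst \<sigma> B"
| "subst \<sigma> (A \<^bold>\<or> B) = subst \<sigma> A \<^bold>\<or> subst \<sigma> B"
| "subst \<sigma> (A \<^bold>\<supset> B) = subst \<sigma> A \<^bold>\<supset> subst \<sigma> B"

lemma HLuk_axiom_subst: "HLuk_axiom A \<Longrightarrow> HLuk_axiom (subst \<sigma> A)"
  by (induction rule: HLuk_axiom.induct) (auto intro: HLuk_axiom.intros)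

text \<open>One derivation with variables as metavariables is replayed under every substitution, so
  \<open>k\<close> is chosen before \<open>\<sigma>\<close>.\<close>

lemma prv_uniform_bound:
  assumes "S \<tturnstile> A"
  shows "\<exists>k. \<forall>\<sigma>. derives_in (subst \<sigma> ` S) k {subst \<sigma> A}"
  using assms
proof induction
  case (hyp A)
  then show ?case
    by (intro exI[of _ 0]) (auto intro: derives_in_hyp)
next
  case (ax A)
  then show ?case
    by (intro exI[of _ 1]) (auto intro!: derives_in_ax HLuk_axiom_subst simp del: One_nat_def)
next
  case (mp A B)
  then obtain k m where
    "\<And>\<sigma>. derives_in (subst \<sigma> ` S) k {subst \<sigma> A}"
    "\<And>\<sigma>. derives_in (subst \<sigma> ` S) m {subst \<sigma> (A \<^bold>\<supset> B)}"
    by blast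
  then have "derives_in (subst \<sigma> ` S) (k + m + 1) {subst \<sigma> B}" for \<sigma>
    by (rule derives_in_then[OF derives_in_Un derives_in_mp[of "subst \<sigma> A"]]) auto
  then show ?case
    by blast
qed

text \<open>Inductive step for comparing two conjunctions along a list, when the head
  \<open>B\<close> belongs to both.\<close>

lemma conj_keep_bound:
  "\<exists>k. \<forall>G A D B. derives_in {(G \<^bold>\<and> A) \<^bold>\<supset> D} k {((B \<^bold>\<and> G) \<^bold>\<and> A) \<^bold>\<supset> (B \<^bold>\<and> D)}"
proof -
  have "S \<tturnstile> ((B \<^bold>\<and> G) \<^bold>\<and> A) \<^bold>\<supset> (B \<^bold>\<and> D)" if "(G \<^bold>\<and> A) \<^bold>\<supset> D \<in> S" for S G A D B
    by (rule prv_imp_conjI[OF prv_trans[OF prv_axs(5) prv_axs(5)]])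
      (rule prv_trans[OF prv_imp_conjI[OF prv_trans[OF prv_axs(5) prv_axs(6)] prv_axs(6)] prv.hyp[OF that]])
  then have "set [(Var 0 \<^bold>\<and> Var 1) \<^bold>\<supset> Var 2] \<tturnstile> ((Var 3 \<^bold>\<and> Var 0) \<^bold>\<and> Var 1) \<^bold>\<supset> (Var 3 \<^bold>\<and> Var 2)"
    by simp
  from prv_uniform_bound[OF this] obtain k where k: "\<forall>\<sigma>. derives_in (subst \<sigma> ` set [(Var 0 \<^bold>\<and> Var 1) \<^bold>\<supset> Var 2]) k
      {subst \<sigma> (((Var 3 \<^bold>\<and> Var 0) \<^bold>\<and> Var 1) \<^bold>\<supset> (Var 3 \<^bold>\<and> Var 2))}" ..
  \<comment> \<open>The substitution \<open>nth [G, A, D, B]\<close> sends \<open>Var i\<close> to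
    the entry at index \<open>i\<close>.\<close>
  have "derives_in {(G \<^bold>\<and> A) \<^bold>\<supset> D} k {((B \<^bold>\<and> G) \<^bold>\<and> A) \<^bold>\<supset> (B \<^bold>\<and> D)}" for G A D B
    using k[rule_format, of "nth [G, A, D, B]"] by simp
  then show ?thesis
    by blast
qed

text \<open>The inductive step when \<open>B\<close> occurs only on the left.\<close>

lemma conj_drop_bound:
  "\<exists>k. \<forall>G A D B. derives_in {(G \<^bold>\<and> A) \<^bold>\<supset> D} k {((B \<^bold>\<and> G) \<^bold>\<and> A) \<^bold>\<supset> D}"
proof -
  have "S \<tturnstile> ((B \<^bold>\<and> G) \<^bold>\<and> A) \<^bold>\<supset> D" if "(G \<^bold>\<and> A) \<^bold>\<supset> D \<in> S" for S G A D B
    by (rule prv_trans[OF prv_imp_conjI[OF prv_trans[OF prv_axs(5) prv_axs(6)] prv_axs(6)] prv.hyp[OF that]])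
  then have "set [(Var 0 \<^bold>\<and> Var 1) \<^bold>\<supset> Var 2] \<tturnstile> ((Var 3 \<^bold>\<and> Var 0) \<^bold>\<and> Var 1) \<^bold>\<supset> Var 2"
    by simp
  from prv_uniform_bound[OF this] obtain k where k: "\<forall>\<sigma>. derives_in (subst \<sigma> ` set [(Var 0 \<^bold>\<and> Var 1) \<^bold>\<supset> Var 2]) k
      {subst \<sigma> (((Var 3 \<^bold>\<and> Var 0) \<^bold>\<and> Var 1) \<^bold>\<supset> Var 2)}" ..
  have "derives_in {(G \<^bold>\<and> A) \<^bold>\<supset> D} k {((B \<^bold>\<and> G) \<^bold>\<and> A) \<^bold>\<supset> D}" for G A D B
    using k[rule_format, of "nth [G, A, D, B]"] by simp
  then show ?thesis
    by blast
qed

text \<open>The inductive step when the head is the extra formula \<open>A\<close> and occurs only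
  on the right.\<close>

lemma conj_add_bound:
  "\<exists>k. \<forall>G A D. derives_in {(G \<^bold>\<and> A) \<^bold>\<supset> D} k {(G \<^bold>\<and> A) \<^bold>\<supset> (A \<^bold>\<and> D)}"
proof -
  have "set [(Var 0 \<^bold>\<and> Var 1) \<^bold>\<supset> Var 2] \<tturnstile> (Var 0 \<^bold>\<and> Var 1) \<^bold>\<supset> (Var 1 \<^bold>\<and> Var 2)"
    by (intro prv_imp_conjI prv_axs(6) prv.hyp) simp
  from prv_uniform_bound[OF this] obtain k where k: "\<forall>\<sigma>. derives_in (subst \<sigma> ` set [(Var 0 \<^bold>\<and> Var 1) \<^bold>\<supset> Var 2]) k
      {subst \<sigma> ((Var 0 \<^bold>\<and> Var 1) \<^bold>\<supset> (Var 1 \<^bold>\<and> Var 2))}" ..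
  have "derives_in {(G \<^bold>\<and> A) \<^bold>\<supset> D} k {(G \<^bold>\<and> A) \<^bold>\<supset> (A \<^bold>\<and> D)}" for G A D
    using k[rule_format, of "nth [G, A, D]"] by simp
  then show ?thesis
    by blast
qed

lemma weaken_bound: "derives_in {B} 2 {G \<^bold>\<supset> B}"
proof -
  have "derives_in {B} (1 + 1) {G \<^bold>\<supset> B}"
    by (rule derives_in_mono[OF derives_in_cut[OF derives_in_ax[OF ax1[of B G]] derives_in_mp[of B]]])
      auto
  then show ?thesis
    by (simp add: eval_nat_numeral)
qed

text \<open>\<open>T\<close> will be \<open>verum\<close>: it gives the comparisons of antecedents
  the shape \<open>(G \<and> A) \<supset> D\<close> although modus ponens discharges
  nothing.\<close>

lemma mp_bound:
  "\<exists>k. \<forall>T G G1 G2 A B. derives_in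
    {T, (G \<^bold>\<and> T) \<^bold>\<supset> G1, (G \<^bold>\<and> T) \<^bold>\<supset> G2, G1 \<^bold>\<supset> (G1 \<^bold>\<supset> A), G2 \<^bold>\<supset> (G2 \<^bold>\<supset> (A \<^bold>\<supset> B))} k {G \<^bold>\<supset> (G \<^bold>\<supset> B)}"
proof -
  let ?T = "Var 0" and ?G = "Var 1" and ?G1 = "Var 2" and ?G2 = "Var 3" and ?A = "Var 4" and ?B = "Var 5"
  let ?Hs = "[?T, (?G \<^bold>\<and> ?T) \<^bold>\<supset> ?G1, (?G \<^bold>\<and> ?T) \<^bold>\<supset> ?G2, ?G1 \<^bold>\<supset> (?G1 \<^bold>\<supset> ?A), ?G2 \<^bold>\<supset> (?G2 \<^bold>\<supset> (?A \<^bold>\<supset> ?B))]"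
  let ?S = "insert ?G (set ?Hs)"
  have GT: "?S \<tturnstile> ?G \<^bold>\<and> ?T"
    by (intro prv_conjI prv.hyp) auto
  have "?S \<tturnstile> ?G1" "?S \<tturnstile> ?G2"
    by (rule prv.mp[OF GT prv.hyp], simp)+
  then have "?S \<tturnstile> ?A" "?S \<tturnstile> ?A \<^bold>\<supset> ?B"
    by - (rule prv_undeduction[OF _ prv.hyp], assumption, simp)+
  then have "set ?Hs \<tturnstile> ?G \<^bold>\<supset> (?G \<^bold>\<supset> ?B)"
    by (intro prv_deduction prv.mp[of _ ?A ?B])
  from prv_uniform_bound[OF this] obtain k where k: "\<forall>\<sigma>. derives_in (subst \<sigma> ` set ?Hs) k
      {subst \<sigma> (?G \<^bold>\<supset> (?G \<^bold>\<supset> ?B))}" ..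
  have "derives_in {T, (G \<^bold>\<and> T) \<^bold>\<supset> G1, (G \<^bold>\<and> T) \<^bold>\<supset> G2, G1 \<^bold>\<supset> (G1 \<^bold>\<supset> A), G2 \<^bold>\<supset> (G2 \<^bold>\<supset> (A \<^bold>\<supset> B))} k
      {G \<^bold>\<supset> (G \<^bold>\<supset> B)}" for T G G1 G2 A B
    using k[rule_format, of "nth [T, G, G1, G2, A, B]"] by simp
  then show ?thesis
    by blast
qed

text \<open>\<open>G\<close> stands for the antecedent of the conclusion; the discharged
  \<open>A\<close> and \<open>B\<close> are added to it for the second and third premises, and a
  trivial \<open>T\<close> for the first.\<close>

lemma disjE_bound:
  "\<exists>k. \<forall>T G G1 G2 G3 A B C. derives_in
    {T, (G \<^bold>\<and> T) \<^bold>\<supset> G1, (G \<^bold>\<and> A) \<^bold>\<supset> G2, (G \<^bold>\<and> B) \<^bold>\<supset> G3,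
     G1 \<^bold>\<supset> (G1 \<^bold>\<supset> (A \<^bold>\<or> B)), G2 \<^bold>\<supset> (G2 \<^bold>\<supset> C), G3 \<^bold>\<supset> (G3 \<^bold>\<supset> C)} k {G \<^bold>\<supset> (G \<^bold>\<supset> C)}"
proof -
  let ?T = "Var 0" and ?G = "Var 1" and ?G1 = "Var 2" and ?G2 = "Var 3" and ?G3 = "Var 4"
    and ?A = "Var 5" and ?B = "Var 6" and ?C = "Var 7"
  let ?Hs = "[?T, (?G \<^bold>\<and> ?T) \<^bold>\<supset> ?G1, (?G \<^bold>\<and> ?A) \<^bold>\<supset> ?G2, (?G \<^bold>\<and> ?B) \<^bold>\<supset> ?G3,
     ?G1 \<^bold>\<supset> (?G1 \<^bold>\<supset> (?A \<^bold>\<or> ?B)), ?G2 \<^bold>\<supset> (?G2 \<^bold>\<supset> ?C), ?G3 \<^bold>\<supset> (?G3 \<^bold>\<supset> ?C)]"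
  let ?S = "insert ?G (set ?Hs)"
  have use: "S \<tturnstile> X" if "?G \<in> S" "Y \<in> S" "(?G \<^bold>\<and> Y) \<^bold>\<supset> H \<in> S" "H \<^bold>\<supset> (H \<^bold>\<supset> X) \<in> S" for S X Y H
  proof -
    have "S \<tturnstile> H"
      using that by (meson prv.hyp prv.mp prv_conjI)
    then show ?thesis
      by (rule prv_undeduction) (rule prv.hyp[OF that(4)])
  qed
  have "?S \<tturnstile> ?A \<^bold>\<or> ?B"
    by (rule use[of _ ?T ?G1]) auto
  moreover have "insert ?A ?S \<tturnstile> ?C"
    by (rule use[of _ ?A ?G2]) auto
  moreover have "insert ?B ?S \<tturnstile> ?C"
    by (rule use[of _ ?B ?G3]) auto
  ultimately have "set ?Hs \<tturnstile> ?G \<^bold>\<supset> (?G \<^bold>\<supset> ?C)"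
    by (intro prv_deduction) (rule prv_disjE)
  from prv_uniform_bound[OF this] obtain k where k: "\<forall>\<sigma>. derives_in (subst \<sigma> ` set ?Hs) k
      {subst \<sigma> (?G \<^bold>\<supset> (?G \<^bold>\<supset> ?C))}" ..
  have "derives_in {T, (G \<^bold>\<and> T) \<^bold>\<supset> G1, (G \<^bold>\<and> A) \<^bold>\<supset> G2, (G \<^bold>\<and> B) \<^bold>\<supset> G3,
     G1 \<^bold>\<supset> (G1 \<^bold>\<supset> (A \<^bold>\<or> B)), G2 \<^bold>\<supset> (G2 \<^bold>\<supset> C), G3 \<^bold>\<supset> (G3 \<^bold>\<supset> C)} k {G \<^bold>\<supset> (G \<^bold>\<supset> C)}"
    for T G G1 G2 G3 A B C
    using k[rule_format, of "nth [T, G, G1, G2, G3, A, B, C]"] by simp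
  then show ?thesis
    by blast
qed

section \<open>Translating sequents\<close>

definition verum :: fm where
  "verum = Var 0 \<^bold>\<supset> (Var 0 \<^bold>\<supset> Var 0)"

lemma derives_in_verum: "derives_in S 1 {verum}"
  unfolding verum_def by (intro derives_in_ax ax1)

primrec conjs :: "fm list \<Rightarrow> fm" where
  "conjs [] = verum"
| "conjs (A # As) = A \<^bold>\<and> conjs As"

text \<open>Filtering \<open>L\<close> fixes the order of the conjuncts. Formulas outside
  \<open>L\<close> are dropped, and repetitions in \<open>L\<close> are kept.\<close>

abbreviation conj_of :: "fm list \<Rightarrow> fm set \<Rightarrow> fm" where
  "conj_of L \<Gamma> \<equiv> conjs (filter (\<lambda>A. A \<in> \<Gamma>) L)"

primrec translate :: "fm list \<Rightarrow> sequent \<Rightarrow> fm" where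
  "translate L (\<Gamma> \<^bold>\<turnstile> C) = conj_of L \<Gamma> \<^bold>\<supset> (conj_of L \<Gamma> \<^bold>\<supset> C)"

primrec succedent :: "sequent \<Rightarrow> fm" where
  "succedent (\<Gamma> \<^bold>\<turnstile> C) = C"

text \<open>Both conjunctions follow the order of \<open>L\<close>, so the implication for the tail
  extends to the head at constant cost.\<close>

lemma conj_of_insert_bound:
  "\<exists>c. \<forall>L \<Gamma> \<Delta> A. \<Delta> \<subseteq> insert A \<Gamma> \<longrightarrow>
     derives_in {} (c * (length L + 1)) {(conj_of L \<Gamma> \<^bold>\<and> A) \<^bold>\<supset> conj_of L \<Delta>}"
proof -
  obtain k1 k2 k3 where
    keep: "derives_in {(G \<^bold>\<and> A) \<^bold>\<supset> D} k1 {((B \<^bold>\<and> G) \<^bold>\<and> A) \<^bold>\<supset> (B \<^bold>\<and> D)}" and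
    drop: "derives_in {(G \<^bold>\<and> A) \<^bold>\<supset> D} k2 {((B \<^bold>\<and> G) \<^bold>\<and> A) \<^bold>\<supset> D}" and
    add: "derives_in {(G \<^bold>\<and> A) \<^bold>\<supset> D} k3 {(G \<^bold>\<and> A) \<^bold>\<supset> (A \<^bold>\<and> D)}" for G A D B
    using conj_keep_bound conj_drop_bound conj_add_bound by metis
  \<comment> \<open>The summand 1 pays for the axiom used when \<open>L\<close> is empty.\<close>
  define c where "c = k1 + k2 + k3 + 1"
  have "derives_in {} (c * (length L + 1)) {(conj_of L \<Gamma> \<^bold>\<and> A) \<^bold>\<supset> conj_of L \<Delta>}"
    if sub: "\<Delta> \<subseteq> insert A \<Gamma>" for L \<Gamma> \<Delta> A
  proof (induction L)
    case Nil
    have "derives_in {} 1 {(verum \<^bold>\<and> A) \<^bold>\<supset> verum}"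
      by (rule derives_in_ax[OF ax5])
    then show ?case
      by (rule derives_in_mono) (auto simp: c_def)
  next
    case (Cons B L)
    let ?G = "conj_of L \<Gamma>" and ?D = "conj_of L \<Delta>"
    have "\<exists>k\<le>c. derives_in {(?G \<^bold>\<and> A) \<^bold>\<supset> ?D} k {(conj_of (B # L) \<Gamma> \<^bold>\<and> A) \<^bold>\<supset> conj_of (B # L) \<Delta>}"
    proof (cases "B \<in> \<Gamma>")
      case True
      then show ?thesis
        using keep drop by (cases "B \<in> \<Delta>") (auto simp: c_def intro: exI[of _ k1] exI[of _ k2])
    next
      case False
      then have "B = A" if "B \<in> \<Delta>"
        using sub that by auto
      then show ?thesis
        using False add derives_in_hyp[of "{(?G \<^bold>\<and> A) \<^bold>\<supset> ?D}"]
        by (cases "B \<in> \<Delta>") (auto simp: c_def intro: exI[of _ k3] exI[of _ 0])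
    qed
    then obtain k where k: "k \<le> c"
      "derives_in {(?G \<^bold>\<and> A) \<^bold>\<supset> ?D} k {(conj_of (B # L) \<Gamma> \<^bold>\<and> A) \<^bold>\<supset> conj_of (B # L) \<Delta>}"
      by blast
    show ?case
      by (rule derives_in_mono[OF derives_in_then[OF Cons k(2)]]) (use k(1) in auto)
  qed
  then show ?thesis
    by blast
qed

text \<open>Membership in \<open>L\<close> ensures that the antecedent \<open>{A}\<close> is
  translated to a conjunction starting with \<open>A\<close>. An instance of an axiom schema costs
  one line and two weakenings of two lines each.\<close>

lemma translate_axiom_bound:
  assumes "L3or_axiom s" "succedent s \<in> set L"
  shows "derives_in {} 5 {translate L s}"
  using assms(1)
proof cases
  case (HLuk A)
  then show ?thesis
    using derives_in_then[OF derives_in_ax derives_in_then[OF weaken_bound weaken_bound]]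
    by (simp add: eval_nat_numeral)
next
  case (assumption A)
  then have "filter (\<lambda>B. B \<in> {A}) L \<noteq> []"
    using assms(2) by (auto simp: filter_empty_conv)
  then obtain As where "filter (\<lambda>B. B \<in> {A}) L = A # As"
    by (metis (mono_tags, lifting) filter_eq_ConsD neq_Nil_conv singletonD)
  then have "translate L s = ((A \<^bold>\<and> conjs As) \<^bold>\<supset> ((A \<^bold>\<and> conjs As) \<^bold>\<supset> A))"
    using assumption by simp
  moreover have "derives_in {} (1 + 2) {(A \<^bold>\<and> conjs As) \<^bold>\<supset> ((A \<^bold>\<and> conjs As) \<^bold>\<supset> A)}"
    by (rule derives_in_then[OF derives_in_ax[OF ax5] weaken_bound])
  ultimately show ?thesis
    using derives_in_mono[of "{}" "1 + 2" _ "{}" 5] by simp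
qed

lemma translate_mp_bound:
  "\<exists>c. \<forall>L r s t. L3or_mp r s t \<longrightarrow>
     derives_in {translate L r, translate L s} (c * (length L + 1)) {translate L t}"
proof -
  obtain c where c: "\<Delta> \<subseteq> insert A \<Gamma> \<Longrightarrow>
      derives_in {} (c * (length L + 1)) {(conj_of L \<Gamma> \<^bold>\<and> A) \<^bold>\<supset> conj_of L \<Delta>}" for L \<Gamma> \<Delta> A
    using conj_of_insert_bound by blast
  obtain k where k: "derives_in
    {T, (G \<^bold>\<and> T) \<^bold>\<supset> G1, (G \<^bold>\<and> T) \<^bold>\<supset> G2, G1 \<^bold>\<supset> (G1 \<^bold>\<supset> A), G2 \<^bold>\<supset> (G2 \<^bold>\<supset> (A \<^bold>\<supset> B))} k {G \<^bold>\<supset> (G \<^bold>\<supset> B)}"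
    for T G G1 G2 A B
    using mp_bound by blast
  have "derives_in {translate L r, translate L s} ((2 * c + k + 1) * (length L + 1)) {translate L t}"
    if "L3or_mp r s t" for L r s t
    using that
  proof cases
    case (1 \<Gamma>1 A \<Gamma>2 B)
    let ?S = "{translate L r, translate L s}" and ?G = "conj_of L (\<Gamma>1 \<union> \<Gamma>2)" and ?m = "c * (length L + 1)"
    have sub: "derives_in ?S ?m {(?G \<^bold>\<and> verum) \<^bold>\<supset> conj_of L \<Gamma>1}"
      "derives_in ?S ?m {(?G \<^bold>\<and> verum) \<^bold>\<supset> conj_of L \<Gamma>2}"
      by (rule derives_in_mono[OF c[of _ verum "\<Gamma>1 \<union> \<Gamma>2"]]; blast)+
    \<comment> \<open>The summands count the given translations, \<open>verum\<close>, the two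
      comparisons of antecedents, and the schema.\<close>
    have "derives_in ?S (0 + (1 + (?m + ?m)) + k) {?G \<^bold>\<supset> (?G \<^bold>\<supset> B)}"
      by (rule derives_in_then[OF derives_in_Un[OF derives_in_hyp[OF subset_refl]
              derives_in_Un[OF derives_in_verum derives_in_Un[OF sub]]]
            derives_in_mono[OF k[of verum _ "conj_of L \<Gamma>1" "conj_of L \<Gamma>2" A B]]])
        (auto simp: 1)
    then show ?thesis
      by (rule derives_in_mono) (auto simp: 1 algebra_simps)
  qed
  then show ?thesis
    by blast
qed

lemma translate_disjE_bound:
  "\<exists>c. \<forall>L q r s t. L3or_disjE q r s t \<longrightarrow>
     derives_in {translate L q, translate L r, translate L s} (c * (length L + 1)) {translate L t}"
proof -
  obtain c where c: "\<Delta> \<subseteq> insert A \<Gamma> \<Longrightarrow>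
      derives_in {} (c * (length L + 1)) {(conj_of L \<Gamma> \<^bold>\<and> A) \<^bold>\<supset> conj_of L \<Delta>}" for L \<Gamma> \<Delta> A
    using conj_of_insert_bound by blast
  obtain k where k: "derives_in
    {T, (G \<^bold>\<and> T) \<^bold>\<supset> G1, (G \<^bold>\<and> A) \<^bold>\<supset> G2, (G \<^bold>\<and> B) \<^bold>\<supset> G3,
     G1 \<^bold>\<supset> (G1 \<^bold>\<supset> (A \<^bold>\<or> B)), G2 \<^bold>\<supset> (G2 \<^bold>\<supset> C), G3 \<^bold>\<supset> (G3 \<^bold>\<supset> C)} k {G \<^bold>\<supset> (G \<^bold>\<supset> C)}"
    for T G G1 G2 G3 A B C
    using disjE_bound by blast
  have "derives_in {translate L q, translate L r, translate L s}
      ((3 * c + k + 1) * (length L + 1)) {translate L t}"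
    if "L3or_disjE q r s t" for L q r s t
    using that
  proof cases
    case (1 \<Gamma>1 A B \<Gamma>2 C \<Gamma>3)
    let ?S = "{translate L q, translate L r, translate L s}"
      and ?G = "conj_of L (\<Gamma>1 \<union> (\<Gamma>2 - {A}) \<union> (\<Gamma>3 - {B}))"
      and ?G1 = "conj_of L \<Gamma>1" and ?G2 = "conj_of L (\<Gamma>2 \<union> {A})" and ?G3 = "conj_of L (\<Gamma>3 \<union> {B})"
      and ?m = "c * (length L + 1)"
    \<comment> \<open>Each premise antecedent lies in that of the conclusion plus what the premise
      discharges; the first discharges nothing, hence \<open>verum\<close>.\<close>
    have sub: "derives_in ?S ?m {(?G \<^bold>\<and> verum) \<^bold>\<supset> ?G1}"
      "derives_in ?S ?m {(?G \<^bold>\<and> A) \<^bold>\<supset> ?G2}" "derives_in ?S ?m {(?G \<^bold>\<and> B) \<^bold>\<supset> ?G3}"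
      by (rule derives_in_mono[OF c[of _ _ "\<Gamma>1 \<union> (\<Gamma>2 - {A}) \<union> (\<Gamma>3 - {B})"]]; blast)+
    have "derives_in ?S (0 + (1 + (?m + (?m + ?m))) + k) {?G \<^bold>\<supset> (?G \<^bold>\<supset> C)}"
      by (rule derives_in_then[OF derives_in_Un[OF derives_in_hyp[OF subset_refl]
              derives_in_Un[OF derives_in_verum derives_in_Un[OF sub(1) derives_in_Un[OF sub(2,3)]]]]
            derives_in_mono[OF k[of verum _ ?G1 A ?G2 B ?G3 C]]])
        (auto simp: 1)
    then show ?thesis
      by (rule derives_in_mono) (auto simp: 1 algebra_simps)
  qed
  then show ?thesis
    by blast
qed

section \<open>Asymptotic comparison and assembly of the bound\<close>

lemma quadratic_bigo: "(\<lambda>n. real c * (real n + 1) ^ 2) \<in> O(\<lambda>n. real n ^ 2 * ln (real n))"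
\<comment> \<open>From 3 on, \<open>ln (real n)\<close> is at least 1 because e is at most 3; the
  factor 4 comes from \<open>n + 1 \<le> 2 * n\<close>.\<close>
proof (rule bigoI[where c = "4 * real c"], rule eventually_mono[OF eventually_ge_at_top[of 3]])
  fix n :: nat assume n: "n \<ge> 3"
  have "1 \<le> ln (3 :: real)"
    using exp_le by (subst ln_ge_iff) auto
  also have "\<dots> \<le> ln (real n)"
    using n by simp
  finally have ln: "1 \<le> ln (real n)" .
  have "(real n + 1) ^ 2 \<le> (2 * real n) ^ 2"
    using n by (intro power_mono) auto
  also have "\<dots> \<le> 4 * (real n ^ 2 * ln (real n))"
    using ln mult_left_mono[OF ln, of "real n ^ 2"] by (simp add: power_mult_distrib)
  finally have "real c * (real n + 1) ^ 2 \<le> real c * (4 * (real n ^ 2 * ln (real n)))"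
    by (intro mult_left_mono) auto
  then show "norm (real c * (real n + 1) ^ 2) \<le> 4 * real c * norm (real n ^ 2 * ln (real n))"
    using ln by (simp add: abs_mult mult_ac)
qed

theorem theorem9:
  shows "\<exists>f :: nat \<Rightarrow> real.
           f \<in> O(\<lambda>n. real n ^ 2 * ln (real n)) \<and>
           (\<forall>n D. (\<exists>ss. L3or_proof ss D \<and> length ss = n) \<longrightarrow>
                  (\<exists>ps. HLuk_proof ps D \<and> real (length ps) \<le> f n))"
proof -
  obtain c1 c2 where
    mp: "L3or_mp r s t \<Longrightarrow>
      derives_in {translate L r, translate L s} (c1 * (length L + 1)) {translate L t}" and
    disjE: "L3or_disjE q r s t \<Longrightarrow>
      derives_in {translate L q, translate L r, translate L s} (c2 * (length L + 1)) {translate L t}"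
    for L q r s t
    using translate_mp_bound translate_disjE_bound by metis
  define c where "c = c1 + c2 + 5"
  have "\<exists>ps. HLuk_proof ps D \<and> real (length ps) \<le> real c * (real n + 1) ^ 2"
    if ss: "L3or_proof ss D" "length ss = n" for n D ss
  proof -
    \<comment> \<open>This list has length \<open>n\<close> and contains the succedent of every
      assumption line, as \<open>translate_axiom_bound\<close> requires.\<close>
    define L where "L = map succedent ss"
    define m where "m = c * (n + 1)"
    have "m \<ge> 5" "m \<ge> c1 * (length L + 1)" "m \<ge> c2 * (length L + 1)"
      by (auto simp: m_def c_def L_def ss(2) algebra_simps)
    note m = this
    \<comment> \<open>All translations of the first \<open>i\<close> sequents are available
      together, so each new sequent adds at most \<open>m\<close> lines.\<close>
    have "derives_in {} (i * m) (translate L ` set (take i ss))" if "i \<le> n" for i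
      using that
    proof (induction i)
      case 0
      show ?case
        by (simp add: derives_in_hyp)
    next
      case (Suc i)
      let ?T = "translate L ` set (take i ss)"
      have i: "i < length ss"
        using Suc.prems ss(2) by simp
      have earlier: "translate L (ss ! j) \<in> ?T" if "j < i" for j
        using that i by (intro imageI) (auto simp: in_set_conv_nth)
      consider "L3or_axiom (ss ! i)"
        | j k where "j < i" "k < i" "L3or_mp (ss ! j) (ss ! k) (ss ! i)"
        | j k l where "j < i" "k < i" "l < i" "L3or_disjE (ss ! j) (ss ! k) (ss ! l) (ss ! i)"
        using ss(1) i unfolding L3or_proof_def by blast
      then have "derives_in ?T m {translate L (ss ! i)}"
      proof cases
        case 1
        then have "derives_in {} 5 {translate L (ss ! i)}"
          using i by (intro translate_axiom_bound) (auto simp: L_def)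
        then show ?thesis
          by (rule derives_in_mono) (use m(1) in auto)
      next
        case 2
        show ?thesis
          by (rule derives_in_mono[OF mp[OF 2(3)]]) (use 2 earlier m(2) in auto)
      next
        case 3
        show ?thesis
          by (rule derives_in_mono[OF disjE[OF 3(4)]]) (use 3 earlier m(3) in auto)
      qed
      then have "derives_in {} (i * m + m) (?T \<union> {translate L (ss ! i)})"
        using Suc by (intro derives_in_cut) auto
      then show ?case
        using i by (simp add: take_Suc_conv_app_nth add.commute)
    qed
    from this[of n] have all: "derives_in {} (n * m) (translate L ` set ss)"
      using ss(2) by simp
    have "ss \<noteq> []" "last ss = ({} \<^bold>\<turnstile> D)"
      using ss(1) by (auto simp: L3or_proof_def)
    then have "({} \<^bold>\<turnstile> D) \<in> set ss"
      by (metis last_in_set)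
    \<comment> \<open>The empty antecedent becomes \<open>verum\<close>; proving it and detaching it
      twice costs the three final lines.\<close>
    then have "verum \<^bold>\<supset> (verum \<^bold>\<supset> D) \<in> translate L ` set ss"
      by (force intro: image_eqI)
    then have "derives_in (translate L ` set ss) (1 + (1 + 1)) ({verum} \<union> ({verum \<^bold>\<supset> D} \<union> {D}))"
      by (intro derives_in_cut derives_in_verum derives_in_mp[of verum]) auto
    from derives_in_then[OF all this] have "derives_in {} (n * m + 3) {D}"
      by (rule derives_in_mono) auto
    then obtain ps where "HLuk_proof ps D" "length ps \<le> n * m + 3"
      using HLuk_proof_if_derives_in by blast
    moreover have "n * m + 3 \<le> c * (n + 1) ^ 2"
      by (simp add: m_def c_def algebra_simps power2_eq_square)
    then have "real (n * m + 3) \<le> real (c * (n + 1) ^ 2)"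
      by (rule of_nat_mono)
    ultimately have "real (length ps) \<le> real (c * (n + 1) ^ 2)"
      by linarith
    then show ?thesis
      using \<open>HLuk_proof ps D\<close> by (auto simp: add.commute)
  qed
  then show ?thesis
    \<comment> \<open>The shift by 1 matters at \<open>n\<close> = 1, where
      \<open>real n ^ 2 * ln (real n)\<close> vanishes but one-step proofs exist.\<close>
    by (intro exI[of _ "\<lambda>n. real c * (real n + 1) ^ 2"] conjI quadratic_bigo) blast
qed

end
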